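(* Let $G$ be a graph with $n$ vertices and $m$ edges. Let $\mu_1,\dots,\mu_n$ be the eigenvalues of the normalized Laplacian matrix $\mathscr{L}(G)$ and $q_1,\dots,q_n$ the eigenvalues of the normalized signless Laplacian matrix $\mathcal{Q}(G)$. Let $I^1_{\mathscr{L}}(G)$ be the first generalized graph entropy formed from $\mu_1,\dots,\mu_n$, and let $I^1_{\mathcal{Q}}(G)$, $I^2_\alpha(G)$, $I^3_\alpha(G)$ be the generalized graph entropies formed from $q_1,\dots,q_n$. Then for $\alpha\ne1$: (i) $I^1_{\mathscr{L}}(G)=I^1_{\mathcal{Q}}(G)=1-\frac{1}{n^2}\left(n+2R_{-1}(G)\right)$; (ii) $I_\alpha^2(G)=\frac{1}{1-\alpha}\log\frac{M_\alpha^*}{n^\alpha}$; (iii) $I_\alpha^3(G)=\frac{1}{2^{1-\alpha}-1}\left(\frac{M_\alpha^*}{n^\alpha}-1\right)$, where $R_{-1}(G)$ is the general Randić index $R_\beta(G)$ of $G$ with $\beta=-1$ and $M_\alpha^*=\sum_{i=1}^n|q_i|^\alpha$.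
   Context: The graph $G$ has vertices $v_1,\dots,v_n$ of degrees $d_1,\dots,d_n$. Let $D(G)=\mathrm{diag}(d_1,\dots,d_n)$, let $A(G)$ be the adjacency matrix, and let $L(G)=D(G)-A(G)$ and $Q(G)=D(G)+A(G)$ be the Laplacian and signless Laplacian matrices. Then $\mathscr{L}(G)=D(G)^{-1/2}L(G)D(G)^{-1/2}$ and $\mathcal{Q}(G)=D(G)^{-1/2}Q(G)D(G)^{-1/2}$. The general Randić index is $R_\beta(G)=\sum_{i\sim j}(d_id_j)^\beta$, the sum over all edges $v_iv_j$ (each counted once). For numbers $\lambda_1,\dots,\lambda_n$ (listed with multiplicity), put $p_i=|\lambda_i|/\sum_{j=1}^n|\lambda_j|$. The generalized graph entropies formed from $\lambda_1,\dots,\lambda_n$ are $I^1=\sum_{i=1}^n p_i(1-p_i)$, $\quad I^2_\alpha=\frac{1}{1-\alpha}\log\left(\sum_{i=1}^n p_i^\alpha\right)$, $\quad I^3_\alpha=\frac{\sum_{i=1}^n p_i^\alpha-1}{2^{1-\alpha}-1}$ for $\alpha\ne1$, where $\log$ is the logarithm to a fixed base. The subscript on $I^1$ names the matrix used. *)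

theory Defs
  imports
    "HOL-Analysis.Analysis"
    "Graph_Theory.Digraph"
    "Jordan_Normal_Form.Char_Poly"
begin

text \<open>
  A finite simple graph is a \<open>graph\<close> in the sense of Graph_Theory: a finite, loop-free,
  symmetric digraph without parallel arcs. Each undirected edge is thus a pair of opposite arcs, so
  the degree of a vertex is its \<open>out_degree\<close>, and edges counted once are the sets \<open>{u, v}\<close>.
\<close>

definition undirected_edges :: "('a, 'b) pre_digraph \<Rightarrow> 'a set set" where
  "undirected_edges G = {{u, v} | u v. u \<rightarrow>\<^bsub>G\<^esub> v}"

definition general_randic :: "real \<Rightarrow> ('a, 'b) pre_digraph \<Rightarrow> real" where
  "general_randic \<beta> G = (\<Sum>e\<in>undirected_edges G. (\<Prod>v\<in>e. real (out_degree G v)) powr \<beta>)"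

text \<open>
  The matrices depend on the list \<open>vs\<close> enumerating the vertices; \<open>vs ! i\<close> is the vertex
  of row and column \<open>i\<close>.
\<close>

definition adjacency_mat :: "('a, 'b) pre_digraph \<Rightarrow> 'a list \<Rightarrow> real mat" where
  "adjacency_mat G vs =
     mat (length vs) (length vs) (\<lambda>(i, j). if vs ! i \<rightarrow>\<^bsub>G\<^esub> vs ! j then 1 else 0)"

definition degree_mat :: "('a, 'b) pre_digraph \<Rightarrow> 'a list \<Rightarrow> real mat" where
  "degree_mat G vs = mat_diag (length vs) (\<lambda>i. real (out_degree G (vs ! i)))"

text \<open>\<open>D\<^sup>-\<^sup>1\<^sup>/\<^sup>2\<close>, meaningful only if all degrees are positive.\<close>

definition degree_mat_inv_sqrt :: "('a, 'b) pre_digraph \<Rightarrow> 'a list \<Rightarrow> real mat" where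
  "degree_mat_inv_sqrt G vs =
     mat_diag (length vs) (\<lambda>i. real (out_degree G (vs ! i)) powr (- 1 / 2))"

definition laplacian_mat :: "('a, 'b) pre_digraph \<Rightarrow> 'a list \<Rightarrow> real mat" where
  "laplacian_mat G vs = degree_mat G vs - adjacency_mat G vs"

definition signless_laplacian_mat :: "('a, 'b) pre_digraph \<Rightarrow> 'a list \<Rightarrow> real mat" where
  "signless_laplacian_mat G vs = degree_mat G vs + adjacency_mat G vs"

definition normalized_laplacian_mat :: "('a, 'b) pre_digraph \<Rightarrow> 'a list \<Rightarrow> real mat" where
  "normalized_laplacian_mat G vs =
     degree_mat_inv_sqrt G vs * laplacian_mat G vs * degree_mat_inv_sqrt G vs"

definition normalized_signless_laplacian_mat :: "('a, 'b) pre_digraph \<Rightarrow> 'a list \<Rightarrow> real mat" where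
  "normalized_signless_laplacian_mat G vs =
     degree_mat_inv_sqrt G vs * signless_laplacian_mat G vs * degree_mat_inv_sqrt G vs"

text \<open>
  The list \<open>ls\<close> consists of all eigenvalues of \<open>A\<close>, with multiplicity, in some order:
  its members are the roots of the characteristic polynomial. In particular its length is the
  dimension of \<open>A\<close>. Every real symmetric matrix has such a list.
\<close>

definition eigenvalues_with_mult :: "real mat \<Rightarrow> real list \<Rightarrow> bool" where
  "eigenvalues_with_mult A ls \<longleftrightarrow> char_poly A = (\<Prod>l\<leftarrow>ls. [:- l, 1:])"

definition entropy_weights :: "real list \<Rightarrow> real list" where
  "entropy_weights ls = map (\<lambda>l. \<bar>l\<bar> / (\<Sum>k\<leftarrow>ls. \<bar>k\<bar>)) ls"

definition entropy1 :: "real list \<Rightarrow> real" where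
  "entropy1 ls = (\<Sum>p\<leftarrow>entropy_weights ls. p * (1 - p))"

text \<open>
  As \<open>0 powr \<alpha> = 0\<close> for every \<open>\<alpha>\<close>, zero weights contribute nothing to the power sums below,
  also if \<open>\<alpha> \<le> 0\<close>. The parameter \<open>b\<close> is the base of the logarithm.
\<close>

definition entropy2 :: "real \<Rightarrow> real \<Rightarrow> real list \<Rightarrow> real" where
  "entropy2 b \<alpha> ls = 1 / (1 - \<alpha>) * log b (\<Sum>p\<leftarrow>entropy_weights ls. p powr \<alpha>)"

definition entropy3 :: "real \<Rightarrow> real list \<Rightarrow> real" where
  "entropy3 \<alpha> ls = ((\<Sum>p\<leftarrow>entropy_weights ls. p powr \<alpha>) - 1) / (2 powr (1 - \<alpha>) - 1)"

end

theory Submission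
  imports Defs "Jordan_Normal_Form.Schur_Decomposition"
begin

text \<open>
  An eigenvalue list enters the entropies only through three quantities: the sum of its absolute
  values (the normalising constant of the weights), the sum of its squares (for the first entropy)
  and the power sum \<open>M\<close>, which the right-hand sides retain. Hence it suffices to show that
  both normalised matrices have nonnegative eigenvalues with sum \<open>n\<close> and sum of squares
  \<open>n + 2 R\<close>, where \<open>R\<close> is the Randic index with exponent \<open>-1\<close>.

  Since the degrees are positive, both matrices have the form
  \<open>N\<^sub>s = I + s D\<^sup>-\<^sup>1\<^sup>/\<^sup>2 A D\<^sup>-\<^sup>1\<^sup>/\<^sup>2\<close> with \<open>s = -1\<close> or \<open>s = 1\<close>, and only \<open>s\<^sup>2 = 1\<close>
  matters below.

  \<^item> The graph has no loops, so the trace of \<open>N\<^sub>s\<close> is \<open>n\<close>. As \<open>N\<^sub>s\<close> is symmetric, the trace of its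
  square is the sum of the squares of its entries: the diagonal gives \<open>n\<close>, and each of the two arcs
  of an edge \<open>{u, v}\<close> gives \<open>1 / (d\<^sub>u d\<^sub>v)\<close>. By \<open>eigenvalues_power_sums\<close> these traces are the sums of
  the eigenvalues and of their squares.

  \<^item> With \<open>y\<^sub>i = x\<^sub>i / sqrt d\<^sub>i\<close>, the quadratic form of \<open>N\<^sub>s\<close> at \<open>x\<close> is half the sum of
  \<open>(y\<^sub>i + s y\<^sub>j)\<^sup>2\<close> over all arcs \<open>(i, j)\<close>. So it is nonnegative, and so are the eigenvalues
  (\<open>normalized_mat_quadratic_form_nonneg\<close>, \<open>eigenvalues_nonneg\<close>); their absolute values therefore
  sum to the trace \<open>n\<close>.
\<close>

(* The dollar sign, the bullet and the arrow shall denote vector entries, the scalar product of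
   vectors and arcs of a digraph only. *)
unbundle no vec_syntax
unbundle no inner_syntax
unbundle no funcset_syntax

section \<open>Trace and spectrum\<close>

definition mat_trace :: "'a::comm_monoid_add mat \<Rightarrow> 'a" where
  "mat_trace A = (\<Sum>i<dim_row A. A $$ (i, i))"

lemma mat_trace_mult:
  fixes A B :: "'a::comm_semiring_0 mat"
  assumes "A \<in> carrier_mat n m" and "B \<in> carrier_mat m n"
  shows "mat_trace (A * B) = (\<Sum>i<n. \<Sum>j<m. A $$ (i, j) * B $$ (j, i))"
  unfolding mat_trace_def
  using assms by (intro sum.cong) (auto simp: scalar_prod_def lessThan_atLeast0)

lemma mat_trace_mult_commute:
  fixes A B :: "'a::comm_semiring_0 mat"
  assumes "A \<in> carrier_mat n m" and "B \<in> carrier_mat m n"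
  shows "mat_trace (A * B) = mat_trace (B * A)"
proof -
  have "mat_trace (A * B) = (\<Sum>j<m. \<Sum>i<n. A $$ (i, j) * B $$ (j, i))"
    unfolding mat_trace_mult[OF assms] by (rule sum.swap)
  also have "\<dots> = mat_trace (B * A)"
    unfolding mat_trace_mult[OF assms(2,1)] by (simp add: mult.commute)
  finally show ?thesis .
qed

lemma mat_trace_similar:
  fixes A B :: "'a::comm_ring_1 mat"
  assumes "A \<in> carrier_mat n n" and "similar_mat_wit A B P Q"
  shows "mat_trace A = mat_trace B"
proof -
  note wit = similar_mat_witD2[OF assms]
  have "mat_trace A = mat_trace (P * (B * Q))"
    using wit by (simp add: assoc_mult_mat[of P n n B n Q n])
  also have "\<dots> = mat_trace (B * Q * P)"
    using wit by (intro mat_trace_mult_commute[where n = n and m = n]) auto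
  also have "B * Q * P = B"
    using wit by (simp add: assoc_mult_mat[of B n n Q n P n])
  finally show ?thesis .
qed

lemma sum_list_diag_mat:
  fixes f :: "'a \<Rightarrow> 'b::comm_monoid_add"
  assumes "B \<in> carrier_mat n n"
  shows "sum_list (map f (diag_mat B)) = (\<Sum>i<n. f (B $$ (i, i)))"
  using assms
  by (simp add: diag_mat_def o_def sum_list_distinct_conv_sum_set lessThan_atLeast0)

text \<open>
  Triangularise: similarity preserves the trace of a matrix and of its square, and for an upper
  triangular matrix the diagonal of the square is the square of the diagonal.
\<close>

lemma eigenvalues_power_sums:
  assumes A: "A \<in> carrier_mat n n" and ev: "eigenvalues_with_mult A es"
  shows "length es = n"
    and "sum_list es = mat_trace A"
    and "(\<Sum>e\<leftarrow>es. e\<^sup>2) = mat_trace (A * A)"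
proof -
  obtain B P Q where dec: "schur_decomposition A es = (B, P, Q)"
    by (cases "schur_decomposition A es") auto
  have wit: "similar_mat_wit A B P Q" and upper: "upper_triangular B" and diag: "diag_mat B = es"
    using schur_decomposition[OF A _ dec] ev by (auto simp: eigenvalues_with_mult_def)
  have B: "B \<in> carrier_mat n n"
    using similar_mat_witD2[OF A wit] by simp
  show "length es = n"
    using diag B by (auto simp: diag_mat_def)
  show "sum_list es = mat_trace A"
    using sum_list_diag_mat[OF B, of "\<lambda>x. x"] mat_trace_similar[OF A wit] B diag
    by (simp add: mat_trace_def)
  have "similar_mat_wit (A ^\<^sub>m 2) (B ^\<^sub>m 2) P Q"
    by (rule similar_mat_wit_pow[OF wit])
  hence "similar_mat_wit (A * A) (B * B) P Q"
    using A B by (simp add: numeral_2_eq_2)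
  hence "mat_trace (A * A) = mat_trace (B * B)"
    using A by (intro mat_trace_similar) auto
  also have "\<dots> = (\<Sum>i<n. \<Sum>j<n. B $$ (i, j) * B $$ (j, i))"
    by (rule mat_trace_mult[OF B B])
  also have "\<dots> = (\<Sum>i<n. \<Sum>j<n. if j = i then (B $$ (i, i))\<^sup>2 else 0)"
  proof (intro sum.cong refl)
    fix i j assume "i \<in> {..<n}" "j \<in> {..<n}"
    thus "B $$ (i, j) * B $$ (j, i) = (if j = i then (B $$ (i, i))\<^sup>2 else 0)"
      using upper_triangularD[OF upper, of i j] upper_triangularD[OF upper, of j i] B
      by (cases i j rule: linorder_cases) (auto simp: power2_eq_square)
  qed
  also have "\<dots> = (\<Sum>i<n. (B $$ (i, i))\<^sup>2)"
    by simp
  also have "\<dots> = (\<Sum>e\<leftarrow>es. e\<^sup>2)"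
    using sum_list_diag_mat[OF B, of "\<lambda>x. x\<^sup>2"] diag by simp
  finally show "(\<Sum>e\<leftarrow>es. e\<^sup>2) = mat_trace (A * A)" by simp
qed

text \<open>
  If \<open>A x = e x\<close> then the form takes the value \<open>e (x \<bullet> x)\<close> at \<open>x\<close>, and \<open>x \<bullet> x > 0\<close> for \<open>x \<noteq> 0\<close>.
\<close>

lemma eigenvalues_nonneg:
  assumes A: "A \<in> carrier_mat n n" and ev: "eigenvalues_with_mult A es"
    and form: "\<And>x. x \<in> carrier_vec n \<Longrightarrow> x \<bullet> (A *\<^sub>v x) \<ge> 0"
    and e: "e \<in> set es"
  shows "e \<ge> 0"
proof -
  have "poly (char_poly A) e = 0"
    using e ev by (auto simp: eigenvalues_with_mult_def poly_prod_list prod_list_zero_iff)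
  then obtain x where x: "x \<in> carrier_vec n" "x \<noteq> 0\<^sub>v n" "A *\<^sub>v x = e \<cdot>\<^sub>v x"
    using A unfolding eigenvalue_root_char_poly[OF A, symmetric] eigenvalue_def eigenvector_def
    by auto
  have "0 \<le> e * (x \<bullet> x)"
    using form[OF x(1)] x by simp
  moreover have "x \<bullet> x > 0"
    using conjugate_square_greater_0_vec[OF x(1)] x(2) by simp
  ultimately show ?thesis
    by (simp add: zero_le_mult_iff)
qed

section \<open>Entropies of a list of numbers\<close>

text \<open>For \<open>x \<ge> 0\<close> the weights \<open>x / S\<close> sum to 1, so only their squares remain in the entropy.\<close>

lemma entropy1_nonneg:
  assumes "\<And>x. x \<in> set ls \<Longrightarrow> x \<ge> 0" and "sum_list ls = S" and "S \<noteq> 0"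
  shows "entropy1 ls = 1 - (\<Sum>x\<leftarrow>ls. x\<^sup>2) / S\<^sup>2"
proof -
  have map_abs: "map abs ls = ls"
    using assms(1) by (intro map_idI) auto
  have "entropy1 ls = (\<Sum>x\<leftarrow>ls. x / S - x\<^sup>2 / S\<^sup>2)"
    unfolding entropy1_def entropy_weights_def map_map o_def
    using assms by (intro arg_cong[where f = sum_list] map_cong refl)
      (simp add: map_abs field_simps power2_eq_square)
  also have "\<dots> = (\<Sum>x\<leftarrow>ls. x * inverse S) - (\<Sum>x\<leftarrow>ls. x\<^sup>2 * inverse (S\<^sup>2))"
    by (simp add: sum_list_subtractf divide_inverse)
  also have "\<dots> = 1 - (\<Sum>x\<leftarrow>ls. x\<^sup>2) / S\<^sup>2"
    using assms(2,3) by (simp add: sum_list_mult_const divide_inverse)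
  finally show ?thesis .
qed

lemma sum_powr_entropy_weights:
  "(\<Sum>p\<leftarrow>entropy_weights ls. p powr \<alpha>)
    = (\<Sum>x\<leftarrow>ls. \<bar>x\<bar> powr \<alpha>) / (\<Sum>x\<leftarrow>ls. \<bar>x\<bar>) powr \<alpha>"
proof -
  define S where "S = (\<Sum>x\<leftarrow>ls. \<bar>x\<bar>)"
  have "0 \<le> S"
    unfolding S_def by (intro sum_list_nonneg) auto
  hence "(\<Sum>p\<leftarrow>entropy_weights ls. p powr \<alpha>) = (\<Sum>x\<leftarrow>ls. \<bar>x\<bar> powr \<alpha> / S powr \<alpha>)"
    by (simp add: entropy_weights_def o_def powr_divide flip: S_def)
  also have "\<dots> = (\<Sum>x\<leftarrow>ls. \<bar>x\<bar> powr \<alpha>) / S powr \<alpha>"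
    unfolding divide_inverse by (rule sum_list_mult_const)
  finally show ?thesis
    unfolding S_def .
qed

section \<open>Counting edges by arcs\<close>

context graph
begin

lemma dominates_sym: "u \<rightarrow> v \<longleftrightarrow> v \<rightarrow> u"
  using arcs_ends_symmetric[OF sym_arcs] by blast

lemma finite_arcs_ends: "finite (arcs_ends G)"
  by (simp add: arcs_ends_def)

lemma arcs_ends_subset: "arcs_ends G \<subseteq> verts G \<times> verts G"
  by (auto simp: arcs_ends_conv)

lemma out_degree_eq_card: "out_degree G u = card {v. u \<rightarrow> v}"
proof -
  have "inj_on (head G) (out_arcs G u)"
    by (intro inj_onI no_multi_arcs) (auto simp: arc_to_ends_def)
  moreover have "head G ` out_arcs G u = {v. u \<rightarrow> v}"
    by (auto simp: arcs_ends_conv)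
  ultimately show ?thesis
    using card_image unfolding out_degree_def by metis
qed

text \<open>
  Every edge \<open>{u, v}\<close> carries exactly the two arcs \<open>(u, v)\<close> and \<open>(v, u)\<close>, which differ because
  there are no loops.
\<close>

lemma sum_arcs_ends:
  fixes F :: "'a set \<Rightarrow> real"
  shows "(\<Sum>(u, v)\<in>arcs_ends G. F {u, v}) = 2 * (\<Sum>e\<in>undirected_edges G. F e)"
proof -
  let ?ends = "\<lambda>(u, v). {u, v}"
  have edges: "?ends ` arcs_ends G = undirected_edges G"
    by (force simp: undirected_edges_def)
  have "(\<Sum>(u, v)\<in>arcs_ends G. F {u, v})
      = (\<Sum>e\<in>undirected_edges G. \<Sum>p\<in>{p \<in> arcs_ends G. ?ends p = e}. F (?ends p))"
    using sum.image_gen[OF finite_arcs_ends, of "\<lambda>p. F (?ends p)" ?ends]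
    unfolding edges by (simp only: case_prod_unfold)
  also have "\<dots> = (\<Sum>e\<in>undirected_edges G. 2 * F e)"
  proof (intro sum.cong refl)
    fix e assume "e \<in> undirected_edges G"
    then obtain u v where uv: "e = {u, v}" "u \<rightarrow> v"
      by (auto simp: undirected_edges_def)
    have "v \<rightarrow> u"
      using uv(2) dominates_sym by blast
    have "u \<noteq> v"
      using uv(2) adj_not_same by blast
    have "{p \<in> arcs_ends G. ?ends p = e} = {(u, v), (v, u)}"
    proof (rule Set.set_eqI)
      fix p
      show "p \<in> {p \<in> arcs_ends G. ?ends p = e} \<longleftrightarrow> p \<in> {(u, v), (v, u)}"
        unfolding uv(1) using uv(2) \<open>v \<rightarrow> u\<close> by (cases p) (simp add: doubleton_eq_iff, blast)
    qed
    thus "(\<Sum>p\<in>{p \<in> arcs_ends G. ?ends p = e}. F (?ends p)) = 2 * F e"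
      using \<open>u \<noteq> v\<close> uv(1) insert_commute[of v u "{}"] by simp
  qed
  finally show ?thesis
    by (simp add: sum_distrib_left)
qed

lemma general_randic_arcs:
  "2 * general_randic \<beta> G
    = (\<Sum>(u, v)\<in>arcs_ends G. (real (out_degree G u) * real (out_degree G v)) powr \<beta>)"
  unfolding general_randic_def sum_arcs_ends[symmetric]
proof (intro sum.cong refl)
  fix p assume "p \<in> arcs_ends G"
  moreover obtain u v where "p = (u, v)" by (cases p)
  ultimately show "(case p of (u, v) \<Rightarrow> (\<Prod>v\<in>{u, v}. real (out_degree G v)) powr \<beta>)
      = (case p of (u, v) \<Rightarrow> (real (out_degree G u) * real (out_degree G v)) powr \<beta>)"
    using adj_not_same[of u] by (cases "u = v") auto
qed

end

section \<open>The normalised Laplacian matrices\<close>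

lemma index_mat_diag_conjugation:
  fixes A :: "'a::comm_ring_1 mat"
  assumes "A \<in> carrier_mat n n" and "i < n" and "j < n"
  shows "(mat_diag n f * A * mat_diag n g) $$ (i, j) = f i * A $$ (i, j) * g j"
proof -
  have left: "mat_diag n f * A = mat n n (\<lambda>(i, j). f i * A $$ (i, j))"
    by (rule mat_diag_mult_left[OF assms(1)])
  show ?thesis
    unfolding left using assms(2,3) by (subst mat_diag_mult_right[where nr = n]) auto
qed

locale enumerated_graph = graph G for G :: "('a, 'b) pre_digraph" (structure) +
  fixes vs :: "'a list"
  assumes distinct_vs: "distinct vs" and set_vs: "set vs = verts G"
    and degree_pos: "\<And>v. v \<in> verts G \<Longrightarrow> out_degree G v > 0"
begin

abbreviation N :: nat where "N \<equiv> length vs"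

abbreviation deg :: "nat \<Rightarrow> real" where "deg i \<equiv> real (out_degree G (vs ! i))"

definition adj :: "nat \<Rightarrow> nat \<Rightarrow> real" where
  "adj i j = (if vs ! i \<rightarrow> vs ! j then 1 else 0)"

text \<open>
  The matrix \<open>I + s D\<^sup>-\<^sup>1\<^sup>/\<^sup>2 A D\<^sup>-\<^sup>1\<^sup>/\<^sup>2\<close>: the sign \<open>s\<close> lets one argument serve both the Laplacian
  (\<open>s = -1\<close>) and the signless Laplacian (\<open>s = 1\<close>).
\<close>

definition normalized_mat :: "real \<Rightarrow> real mat" where
  "normalized_mat s =
     mat N N (\<lambda>(i, j). (if i = j then 1 else 0) + s * adj i j / sqrt (deg i * deg j))"

lemma normalized_mat_carrier [simp]: "normalized_mat s \<in> carrier_mat N N"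
  by (simp add: normalized_mat_def)

lemma N_eq_card: "N = card (verts G)"
  using distinct_card[OF distinct_vs] set_vs by simp

lemma adj_sym: "adj i j = adj j i"
  using dominates_sym by (simp add: adj_def)

lemma adj_self [simp]: "adj i i = 0"
  using adj_not_same by (auto simp: adj_def)

lemma deg_pos: "i < N \<Longrightarrow> deg i > 0"
  using degree_pos set_vs nth_mem by fastforce

lemma sum_vertices: "(\<Sum>i<N. f (vs ! i)) = (\<Sum>v\<in>verts G. f v)"
  using sum.reindex_bij_betw[OF bij_betw_nth[OF distinct_vs refl set_vs[symmetric]]] by simp

lemma deg_eq_sum: "deg i = (\<Sum>j<N. adj i j)"
proof -
  have "{v. vs ! i \<rightarrow> v} = {v \<in> verts G. vs ! i \<rightarrow> v}"
    using arcs_ends_subset by auto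
  hence "deg i = (\<Sum>v\<in>verts G. if vs ! i \<rightarrow> v then 1 else 0)"
    by (simp add: out_degree_eq_card sum.If_cases Int_def)
  also have "\<dots> = (\<Sum>j<N. adj i j)"
    unfolding adj_def by (rule sum_vertices[symmetric])
  finally show ?thesis .
qed

text \<open>
  Positivity of the degrees is what makes the diagonal entries equal to 1: a vertex of degree 0
  would give a zero row.
\<close>

lemma normalized_entry:
  assumes "i < N" and "j < N"
  shows "deg i powr (- 1 / 2) * ((if i = j then deg i else 0) + s * adj i j) * deg j powr (- 1 / 2)
    = (if i = j then 1 else 0) + s * adj i j / sqrt (deg i * deg j)"
  using deg_pos[OF assms(1)] deg_pos[OF assms(2)]
  by (auto simp: powr_minus powr_half_sqrt real_sqrt_mult field_simps)

lemma normalized_laplacian_mat_eq: "normalized_laplacian_mat G vs = normalized_mat (- 1)"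
proof (rule eq_matI)
  fix i j assume "i < dim_row (normalized_mat (- 1))" "j < dim_col (normalized_mat (- 1))"
  hence ij: "i < N" "j < N" by (auto simp: normalized_mat_def)
  show "normalized_laplacian_mat G vs $$ (i, j) = normalized_mat (- 1) $$ (i, j)"
    using ij normalized_entry[OF ij, of "- 1"]
    unfolding normalized_laplacian_mat_def degree_mat_inv_sqrt_def
    by (subst index_mat_diag_conjugation)
      (auto simp: laplacian_mat_def degree_mat_def adjacency_mat_def normalized_mat_def
        mat_diag_def adj_def)
qed (auto simp: normalized_laplacian_mat_def degree_mat_inv_sqrt_def normalized_mat_def
    mat_diag_def)

lemma normalized_signless_laplacian_mat_eq:
  "normalized_signless_laplacian_mat G vs = normalized_mat 1"
proof (rule eq_matI)
  fix i j assume "i < dim_row (normalized_mat 1)" "j < dim_col (normalized_mat 1)"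
  hence ij: "i < N" "j < N" by (auto simp: normalized_mat_def)
  show "normalized_signless_laplacian_mat G vs $$ (i, j) = normalized_mat 1 $$ (i, j)"
    using ij normalized_entry[OF ij, of 1]
    unfolding normalized_signless_laplacian_mat_def degree_mat_inv_sqrt_def
    by (subst index_mat_diag_conjugation)
      (auto simp: signless_laplacian_mat_def degree_mat_def adjacency_mat_def normalized_mat_def
        mat_diag_def adj_def)
qed (auto simp: normalized_signless_laplacian_mat_def degree_mat_inv_sqrt_def normalized_mat_def
    mat_diag_def)

lemma mat_trace_normalized: "mat_trace (normalized_mat s) = real N"
  by (simp add: mat_trace_def normalized_mat_def)

lemma sum_adj_randic:
  "(\<Sum>i<N. \<Sum>j<N. adj i j / (deg i * deg j)) = 2 * general_randic (- 1) G"
proof -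
  let ?w = "\<lambda>u v. (real (out_degree G u) * real (out_degree G v)) powr (- 1)"
  let ?f = "\<lambda>u v. if u \<rightarrow> v then ?w u v else 0"
  have "(\<Sum>i<N. \<Sum>j<N. adj i j / (deg i * deg j)) = (\<Sum>i<N. \<Sum>j<N. ?f (vs ! i) (vs ! j))"
    by (intro sum.cong refl) (auto simp: adj_def powr_minus_divide)
  also have "\<dots> = (\<Sum>i<N. \<Sum>v\<in>verts G. ?f (vs ! i) v)"
    by (intro sum.cong refl sum_vertices)
  also have "\<dots> = (\<Sum>u\<in>verts G. \<Sum>v\<in>verts G. ?f u v)"
    by (rule sum_vertices)
  also have "\<dots> = (\<Sum>(u, v)\<in>verts G \<times> verts G. ?f u v)"
    by (rule sum.cartesian_product)
  also have "\<dots> = (\<Sum>(u, v)\<in>arcs_ends G. ?w u v)"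
    using arcs_ends_subset by (intro sum.mono_neutral_cong_right) auto
  finally show ?thesis
    by (simp add: general_randic_arcs)
qed

text \<open>
  By symmetry the trace of the square is the sum of the squared entries. No cross term between
  the identity and the adjacency part arises, because the latter vanishes on the diagonal.
\<close>

lemma mat_trace_normalized_square:
  assumes "s\<^sup>2 = 1"
  shows "mat_trace (normalized_mat s * normalized_mat s) = real N + 2 * general_randic (- 1) G"
proof -
  have "mat_trace (normalized_mat s * normalized_mat s)
      = (\<Sum>i<N. \<Sum>j<N. normalized_mat s $$ (i, j) * normalized_mat s $$ (j, i))"
    by (rule mat_trace_mult) auto
  also have "\<dots> = (\<Sum>i<N. \<Sum>j<N. (if j = i then 1 else 0) + adj i j / (deg i * deg j))"
  proof (intro sum.cong refl)
    fix i j assume "i \<in> {..<N}" "j \<in> {..<N}"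
    hence ij: "i < N" "j < N" by auto
    have "s * s = 1"
      using assms by (simp add: power2_eq_square)
    hence "(s * adj i j / sqrt (deg i * deg j)) * (s * adj i j / sqrt (deg i * deg j))
        = adj i j / (deg i * deg j)"
      by (simp add: adj_def)
    thus "normalized_mat s $$ (i, j) * normalized_mat s $$ (j, i)
        = (if j = i then 1 else 0) + adj i j / (deg i * deg j)"
      using ij by (simp add: normalized_mat_def adj_sym[of j i] mult.commute[of "deg j"])
  qed
  also have "\<dots> = real N + 2 * general_randic (- 1) G"
    by (simp add: sum.distrib sum_adj_randic)
  finally show ?thesis .
qed

text \<open>
  In the variables \<open>y\<^sub>i = x\<^sub>i / sqrt d\<^sub>i\<close> the form is \<open>\<Sum>\<^sub>i d\<^sub>i y\<^sub>i\<^sup>2 + s \<Sum>\<^sub>i\<^sub>j a\<^sub>i\<^sub>j y\<^sub>i y\<^sub>j\<close>. As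
  \<open>d\<^sub>i = \<Sum>\<^sub>j a\<^sub>i\<^sub>j\<close>, its first sum equals both \<open>\<Sum>\<^sub>i\<^sub>j a\<^sub>i\<^sub>j y\<^sub>i\<^sup>2\<close> and, \<open>a\<close> being symmetric,
  \<open>\<Sum>\<^sub>i\<^sub>j a\<^sub>i\<^sub>j y\<^sub>j\<^sup>2\<close>. Taking one copy of each completes the square in twice the form.
\<close>

lemma normalized_mat_quadratic_form_nonneg:
  assumes s: "s\<^sup>2 = 1" and x: "x \<in> carrier_vec N"
  shows "x \<bullet> (normalized_mat s *\<^sub>v x) \<ge> 0"
proof -
  define y where "y i = x $ i / sqrt (deg i)" for i
  have sq: "(x $ i)\<^sup>2 = deg i * (y i)\<^sup>2" if "i < N" for i
    using deg_pos[OF that] by (simp add: y_def power_divide)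
  have "x \<bullet> (normalized_mat s *\<^sub>v x)
      = (\<Sum>i<N. \<Sum>j<N. x $ i * (normalized_mat s $$ (i, j) * x $ j))"
    using x by (simp add: scalar_prod_def normalized_mat_def lessThan_atLeast0 sum_distrib_left)
  also have "\<dots> = (\<Sum>i<N. \<Sum>j<N. (if j = i then (x $ i)\<^sup>2 else 0) + s * adj i j * y i * y j)"
    by (intro sum.cong refl)
      (auto simp: normalized_mat_def y_def real_sqrt_mult power2_eq_square field_simps)
  also have "\<dots> = (\<Sum>i<N. deg i * (y i)\<^sup>2) + (\<Sum>i<N. \<Sum>j<N. s * adj i j * y i * y j)"
    by (simp add: sum.distrib sq)
  finally have form: "x \<bullet> (normalized_mat s *\<^sub>v x)
      = (\<Sum>i<N. deg i * (y i)\<^sup>2) + (\<Sum>i<N. \<Sum>j<N. s * adj i j * y i * y j)" .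
  have rows: "(\<Sum>i<N. deg i * (y i)\<^sup>2) = (\<Sum>i<N. \<Sum>j<N. adj i j * (y i)\<^sup>2)"
    by (simp add: deg_eq_sum sum_distrib_right)
  also have "\<dots> = (\<Sum>i<N. \<Sum>j<N. adj i j * (y j)\<^sup>2)"
    by (subst sum.swap) (simp add: adj_sym)
  finally have cols: "(\<Sum>i<N. deg i * (y i)\<^sup>2) = (\<Sum>i<N. \<Sum>j<N. adj i j * (y j)\<^sup>2)" .
  have "2 * (x \<bullet> (normalized_mat s *\<^sub>v x))
      = (\<Sum>i<N. \<Sum>j<N. adj i j * (y i)\<^sup>2) + (\<Sum>i<N. \<Sum>j<N. adj i j * (y j)\<^sup>2)
        + 2 * (\<Sum>i<N. \<Sum>j<N. s * adj i j * y i * y j)"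
    using form rows cols by simp
  also have "\<dots> = (\<Sum>i<N. \<Sum>j<N.
      adj i j * (y i)\<^sup>2 + adj i j * (y j)\<^sup>2 + 2 * (s * adj i j * y i * y j))"
    by (simp add: sum.distrib sum_distrib_left)
  also have "\<dots> = (\<Sum>i<N. \<Sum>j<N. adj i j * (y i + s * y j)\<^sup>2)"
    using s by (intro sum.cong refl) (simp add: power2_sum power_mult_distrib algebra_simps)
  also have "\<dots> \<ge> 0"
    by (intro sum_nonneg) (simp add: adj_def)
  finally show ?thesis by simp
qed

lemma normalized_spectrum:
  assumes s: "s\<^sup>2 = 1" and ev: "eigenvalues_with_mult (normalized_mat s) ls"
  shows "\<And>x. x \<in> set ls \<Longrightarrow> x \<ge> 0"
    and "sum_list ls = real N"
    and "(\<Sum>x\<leftarrow>ls. x\<^sup>2) = real N + 2 * general_randic (- 1) G"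
  using eigenvalues_nonneg[OF normalized_mat_carrier ev normalized_mat_quadratic_form_nonneg[OF s]]
    eigenvalues_power_sums[OF normalized_mat_carrier ev]
  by (auto simp: mat_trace_normalized mat_trace_normalized_square[OF s])

lemma entropy1_normalized:
  assumes "s\<^sup>2 = 1" and "eigenvalues_with_mult (normalized_mat s) ls" and "N \<noteq> 0"
  shows "entropy1 ls = 1 - 1 / (real N)\<^sup>2 * (real N + 2 * general_randic (- 1) G)"
proof -
  note spec = normalized_spectrum[OF assms(1,2)]
  show ?thesis
    using entropy1_nonneg[OF spec(1,2)] assms(3) spec(3) by simp
qed

end

section \<open>The generalised graph entropies\<close>

theorem theorem3p3:
  fixes G :: "('a, 'b) pre_digraph"
    and vs :: "'a list"
    and n m :: nat
    and \<mu> q :: "real list"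
    and \<alpha> b M :: real
  assumes "graph G"
    and "card (verts G) = n" and "n \<ge> 1"
    and "card (undirected_edges G) = m"
    and "\<And>v. v \<in> verts G \<Longrightarrow> out_degree G v > 0"
    and "distinct vs" and "set vs = verts G"
    and "eigenvalues_with_mult (normalized_laplacian_mat G vs) \<mu>"
    and "eigenvalues_with_mult (normalized_signless_laplacian_mat G vs) q"
    and "b > 0" and "b \<noteq> 1"
    and "\<alpha> \<noteq> 1"
    and "M = (\<Sum>x\<leftarrow>q. \<bar>x\<bar> powr \<alpha>)"
  shows "(entropy1 \<mu> = entropy1 q \<and>
          entropy1 q = 1 - 1 / (real n)\<^sup>2 * (real n + 2 * general_randic (- 1) G)) \<and>
         entropy2 b \<alpha> q = 1 / (1 - \<alpha>) * log b (M / real n powr \<alpha>) \<and>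
         entropy3 \<alpha> q = 1 / (2 powr (1 - \<alpha>) - 1) * (M / real n powr \<alpha> - 1)"
proof -
  interpret graph G by fact
  interpret enumerated_graph G vs
    using assms(5-7) by unfold_locales auto
  have N: "length vs = n" "length vs \<noteq> 0"
    using N_eq_card assms(2,3) by auto
  have mu: "eigenvalues_with_mult (normalized_mat (- 1)) \<mu>"
    using assms(8) by (simp add: normalized_laplacian_mat_eq)
  have q: "eigenvalues_with_mult (normalized_mat 1) q"
    using assms(9) by (simp add: normalized_signless_laplacian_mat_eq)
  \<comment> \<open>The eigenvalues are nonnegative, so their absolute values sum to the trace.\<close>
  have "map abs q = q"
    using normalized_spectrum(1)[OF _ q] by (intro map_idI) auto
  hence "(\<Sum>x\<leftarrow>q. \<bar>x\<bar>) = real n"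
    using normalized_spectrum(2)[OF _ q] N by simp
  hence powers: "(\<Sum>p\<leftarrow>entropy_weights q. p powr \<alpha>) = M / real n powr \<alpha>"
    by (simp add: sum_powr_entropy_weights assms(13))
  show ?thesis
    using entropy1_normalized[OF _ mu N(2)] entropy1_normalized[OF _ q N(2)] N(1)
    by (simp add: entropy2_def entropy3_def powers)
qed

end
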